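(* Let $G$ and $G'$ be finite groups with left regular representations $\lambda$ and $\lambda'$ respectively. For $U \in \mathbb{C}^{G\times G'}$ let $\Psi_U:\Lambda_{G'}\to\Lambda_G$ be the linear map determined by $\Psi_U(\lambda'(b)) = \sum_{a\in G} U_{a,b}\,\lambda(a)$ for all $b\in G'$. Then $U$ is a $(G,G')$-transformation matrix if and only if $\Psi_U$ is a unitary isomorphism. Moreover, every unitary isomorphism from $\Lambda_{G'}$ to $\Lambda_G$ is equal to $\Psi_U$ for some $(G,G')$-transformation matrix $U$.
   Context: Identity elements of groups are denoted $e$. $\mathbb{C}^{G\times G'}$ is the set of complex matrices with rows indexed by $G$ and columns indexed by $G'$. A matrix $U\in\mathbb{C}^{G\times G'}$ is a $(G,G')$-transformation matrix if (1) $U$ is unitary (in particular square, so $|G|=|G'|$); (2) $\overline{U_{a,b}}=U_{a^{-1},b^{-1}}$ for all $a\in G$, $b\in G'$; and (3) $U_{ab,c}=\sum_{x,y\in G',\,xy=c}U_{a,x}U_{b,y}$ for all $a,b\in G$, $c\in G'$. The left regular representation $\lambda$ of $G$ is given by the $G\times G$ matrices $(\lambda(g))_{x,y}=\delta_{x,gy}$, and $\Lambda_G:=\operatorname{span}\{\lambda(g):g\in G\}\subseteq\mathbb{C}^{G\times G}$ is the group algebra of $G$ realized as a matrix algebra; similarly for $\lambda'$ and $\Lambda_{G'}$. A unitary isomorphism between such matrix algebras is an algebra isomorphism $\Psi$ that preserves trace, $\operatorname{Tr}(\Psi(M))=\operatorname{Tr}(M)$, and commutes with conjugate transpose, $\Psi(M^\dagger)=\Psi(M)^\dagger$.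 *)

theory Defs
  imports Complex_Main "HOL-Library.Function_Algebras" "HOL-Algebra.Group"
begin

(* A complex I-by-J matrix is a function that vanishes outside I and J, so that equality of
   matrices is equality of functions.  Sums of matrices are pointwise sums of functions; the
   pointwise product on functions is never used. *)

definition cmats :: "'i set \<Rightarrow> 'j set \<Rightarrow> ('i \<Rightarrow> 'j \<Rightarrow> complex) set" where
  "cmats I J = {M. \<forall>i j. i \<notin> I \<or> j \<notin> J \<longrightarrow> M i j = 0}"

definition cmat_scale :: "complex \<Rightarrow> ('i \<Rightarrow> 'j \<Rightarrow> complex) \<Rightarrow> 'i \<Rightarrow> 'j \<Rightarrow> complex" where
  "cmat_scale c M = (\<lambda>i j. c * M i j)"

definition cmat_mult ::
    "'j set \<Rightarrow> ('i \<Rightarrow> 'j \<Rightarrow> complex) \<Rightarrow> ('j \<Rightarrow> 'k \<Rightarrow> complex) \<Rightarrow> 'i \<Rightarrow> 'k \<Rightarrow> complex" where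
  "cmat_mult J M N = (\<lambda>i k. \<Sum>j\<in>J. M i j * N j k)"

definition cmat_one :: "'i set \<Rightarrow> 'i \<Rightarrow> 'i \<Rightarrow> complex" where
  "cmat_one I = (\<lambda>i j. if i \<in> I \<and> i = j then 1 else 0)"

definition cmat_adjoint :: "('i \<Rightarrow> 'j \<Rightarrow> complex) \<Rightarrow> 'j \<Rightarrow> 'i \<Rightarrow> complex" where
  "cmat_adjoint M = (\<lambda>j i. cnj (M i j))"

definition cmat_trace :: "'i set \<Rightarrow> ('i \<Rightarrow> 'i \<Rightarrow> complex) \<Rightarrow> complex" where
  "cmat_trace I M = (\<Sum>i\<in>I. M i i)"

interpretation cmat: vector_space "cmat_scale :: complex \<Rightarrow> ('i \<Rightarrow> 'j \<Rightarrow> complex) \<Rightarrow> _"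
  by unfold_locales (auto simp: cmat_scale_def plus_fun_def fun_eq_iff algebra_simps)

definition cmat_unitary :: "'i set \<Rightarrow> 'j set \<Rightarrow> ('i \<Rightarrow> 'j \<Rightarrow> complex) \<Rightarrow> bool" where
  "cmat_unitary I J U \<longleftrightarrow> U \<in> cmats I J \<and> card I = card J \<and>
     cmat_mult J U (cmat_adjoint U) = cmat_one I \<and>
     cmat_mult I (cmat_adjoint U) U = cmat_one J"

definition transformation_matrix ::
    "('a, 'm) monoid_scheme \<Rightarrow> ('b, 'n) monoid_scheme \<Rightarrow> ('a \<Rightarrow> 'b \<Rightarrow> complex) \<Rightarrow> bool" where
  "transformation_matrix G G' U \<longleftrightarrow>
     cmat_unitary (carrier G) (carrier G') U \<and>
     (\<forall>a\<in>carrier G. \<forall>b\<in>carrier G'. cnj (U a b) = U (inv\<^bsub>G\<^esub> a) (inv\<^bsub>G'\<^esub> b)) \<and>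
     (\<forall>a\<in>carrier G. \<forall>b\<in>carrier G. \<forall>c\<in>carrier G'.
        U (a \<otimes>\<^bsub>G\<^esub> b) c =
          (\<Sum>(x, y)\<in>{(x, y). x \<in> carrier G' \<and> y \<in> carrier G' \<and> x \<otimes>\<^bsub>G'\<^esub> y = c}. U a x * U b y))"

definition left_regular :: "('a, 'm) monoid_scheme \<Rightarrow> 'a \<Rightarrow> 'a \<Rightarrow> 'a \<Rightarrow> complex" where
  "left_regular G g =
     (\<lambda>x y. if x \<in> carrier G \<and> y \<in> carrier G \<and> x = g \<otimes>\<^bsub>G\<^esub> y then 1 else 0)"

definition group_algebra :: "('a, 'm) monoid_scheme \<Rightarrow> ('a \<Rightarrow> 'a \<Rightarrow> complex) set" where
  "group_algebra G = cmat.span (left_regular G ` carrier G)"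

definition cmat_linear_on ::
    "('i \<Rightarrow> 'i \<Rightarrow> complex) set \<Rightarrow> (('i \<Rightarrow> 'i \<Rightarrow> complex) \<Rightarrow> 'j \<Rightarrow> 'j \<Rightarrow> complex) \<Rightarrow> bool" where
  "cmat_linear_on A \<Phi> \<longleftrightarrow>
     (\<forall>M\<in>A. \<forall>N\<in>A. \<Phi> (M + N) = \<Phi> M + \<Phi> N) \<and>
     (\<forall>c. \<forall>M\<in>A. \<Phi> (cmat_scale c M) = cmat_scale c (\<Phi> M))"

(* A and B are algebras of I-by-I and J-by-J matrices.  Preservation of units is not listed,
   since it follows from multiplicativity and surjectivity. *)

definition algebra_iso ::
    "'i set \<Rightarrow> 'j set \<Rightarrow> ('i \<Rightarrow> 'i \<Rightarrow> complex) set \<Rightarrow> ('j \<Rightarrow> 'j \<Rightarrow> complex) set \<Rightarrow>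
     (('i \<Rightarrow> 'i \<Rightarrow> complex) \<Rightarrow> 'j \<Rightarrow> 'j \<Rightarrow> complex) \<Rightarrow> bool" where
  "algebra_iso I J A B \<Phi> \<longleftrightarrow>
     bij_betw \<Phi> A B \<and> cmat_linear_on A \<Phi> \<and>
     (\<forall>M\<in>A. \<forall>N\<in>A. \<Phi> (cmat_mult I M N) = cmat_mult J (\<Phi> M) (\<Phi> N))"

definition unitary_iso ::
    "'i set \<Rightarrow> 'j set \<Rightarrow> ('i \<Rightarrow> 'i \<Rightarrow> complex) set \<Rightarrow> ('j \<Rightarrow> 'j \<Rightarrow> complex) set \<Rightarrow>
     (('i \<Rightarrow> 'i \<Rightarrow> complex) \<Rightarrow> 'j \<Rightarrow> 'j \<Rightarrow> complex) \<Rightarrow> bool" where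
  "unitary_iso I J A B \<Phi> \<longleftrightarrow>
     algebra_iso I J A B \<Phi> \<and>
     (\<forall>M\<in>A. cmat_trace J (\<Phi> M) = cmat_trace I M) \<and>
     (\<forall>M\<in>A. \<Phi> (cmat_adjoint M) = cmat_adjoint (\<Phi> M))"

definition Psi_spec ::
    "('a, 'm) monoid_scheme \<Rightarrow> ('b, 'n) monoid_scheme \<Rightarrow> ('a \<Rightarrow> 'b \<Rightarrow> complex) \<Rightarrow>
     (('b \<Rightarrow> 'b \<Rightarrow> complex) \<Rightarrow> 'a \<Rightarrow> 'a \<Rightarrow> complex) \<Rightarrow> bool" where
  "Psi_spec G G' U \<Psi> \<longleftrightarrow>
     \<Psi> \<in> group_algebra G' \<rightarrow>\<^sub>E group_algebra G \<and>
     cmat_linear_on (group_algebra G') \<Psi> \<and>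
     (\<forall>b\<in>carrier G'. \<Psi> (left_regular G' b) =
        (\<Sum>a\<in>carrier G. cmat_scale (U a b) (left_regular G a)))"

(* The description is proper for finite groups: see Psi_spec_ex1 below. *)

definition Psi ::
    "('a, 'm) monoid_scheme \<Rightarrow> ('b, 'n) monoid_scheme \<Rightarrow> ('a \<Rightarrow> 'b \<Rightarrow> complex) \<Rightarrow>
     ('b \<Rightarrow> 'b \<Rightarrow> complex) \<Rightarrow> 'a \<Rightarrow> 'a \<Rightarrow> complex" where
  "Psi G G' U = (THE \<Psi>. Psi_spec G G' U \<Psi>)"

lemma Psi_spec_ex1:
  fixes G :: "('a, 'm) monoid_scheme" and G' :: "('b, 'n) monoid_scheme"
  assumes "group G'" "finite (carrier G')"
  shows "\<exists>!\<Psi>. Psi_spec G G' U \<Psi>"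
proof -
  interpret G': group G' by fact
  define R where "R = (\<lambda>b. \<Sum>a\<in>carrier G. cmat_scale (U a b) (left_regular G a))"
  define f where "f = (\<lambda>M. \<Sum>b\<in>carrier G'. cmat_scale (M b \<one>\<^bsub>G'\<^esub>) (R b))"
  have R_in: "R b \<in> group_algebra G" for b
    unfolding R_def group_algebra_def
    by (intro cmat.span_sum cmat.span_scale cmat.span_base) auto
  have f_in: "f M \<in> group_algebra G" for M
    unfolding f_def using R_in unfolding group_algebra_def
    by (intro cmat.span_sum cmat.span_scale) auto
  have f_add: "f (M + N) = f M + f N" for M N
    unfolding f_def by (simp add: cmat.scale_left_distrib sum.distrib)
  have f_scale: "f (cmat_scale c M) = cmat_scale c (f M)" for c M
    unfolding f_def by (simp add: cmat.scale_sum_right) (simp add: cmat_scale_def)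
  have f_reg: "f (left_regular G' b) = R b" if b: "b \<in> carrier G'" for b
  proof -
    have "f (left_regular G' b) = (\<Sum>b'\<in>carrier G'. if b' = b then R b' else 0)"
      unfolding f_def
      by (rule sum.cong) (use b in \<open>auto simp: left_regular_def\<close>)
    then show ?thesis using b assms(2) by simp
  qed
  have reg_in: "left_regular G' b \<in> group_algebra G'" if "b \<in> carrier G'" for b
    unfolding group_algebra_def using that by (intro cmat.span_base) auto
  have add_in: "M + N \<in> group_algebra G'"
    if "M \<in> group_algebra G'" "N \<in> group_algebra G'" for M N
    using that unfolding group_algebra_def by (rule cmat.span_add)
  have scale_in: "cmat_scale c M \<in> group_algebra G'" if "M \<in> group_algebra G'" for c M
    using that unfolding group_algebra_def by (rule cmat.span_scale)
  let ?F = "restrict f (group_algebra G')"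
  have F: "Psi_spec G G' U ?F"
    unfolding Psi_spec_def cmat_linear_on_def
    using f_in f_add f_scale f_reg reg_in add_in scale_in by (auto simp: R_def)
  have uniq: "\<Psi> = ?F" if P: "Psi_spec G G' U \<Psi>" for \<Psi>
  proof (rule ext)
    fix M
    have lin: "cmat_linear_on (group_algebra G') \<Psi>"
      and reg: "\<And>b. b \<in> carrier G' \<Longrightarrow> \<Psi> (left_regular G' b) = R b"
      and ext: "\<Psi> \<in> extensional (group_algebra G')"
      using P unfolding Psi_spec_def R_def by (auto simp: PiE_def)
    show "\<Psi> M = ?F M"
    proof (cases "M \<in> group_algebra G'")
      case False
      then show ?thesis using ext by (simp add: extensional_def)
    next
      case True
      have "M \<in> group_algebra G' \<and> \<Psi> M = f M"
      proof (rule cmat.span_induct[OF True[unfolded group_algebra_def]])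
        show "cmat.subspace {M. M \<in> group_algebra G' \<and> \<Psi> M = f M}"
        proof (rule cmat.subspaceI)
          have z: "0 \<in> group_algebra G'"
            unfolding group_algebra_def by (rule cmat.span_zero)
          have "\<Psi> (cmat_scale 0 0) = cmat_scale 0 (\<Psi> 0)"
            using lin z unfolding cmat_linear_on_def by blast
          then have "\<Psi> 0 = 0" by simp
          moreover have "f 0 = 0" using f_scale[of 0 0] by simp
          ultimately show "0 \<in> {M. M \<in> group_algebra G' \<and> \<Psi> M = f M}" using z by simp
        next
          show "x + y \<in> {M. M \<in> group_algebra G' \<and> \<Psi> M = f M}"
            if "x \<in> {M. M \<in> group_algebra G' \<and> \<Psi> M = f M}"
               "y \<in> {M. M \<in> group_algebra G' \<and> \<Psi> M = f M}" for x y
            using that lin add_in f_add unfolding cmat_linear_on_def by simp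
          show "cmat_scale c x \<in> {M. M \<in> group_algebra G' \<and> \<Psi> M = f M}"
            if "x \<in> {M. M \<in> group_algebra G' \<and> \<Psi> M = f M}" for c x
            using that lin scale_in f_scale unfolding cmat_linear_on_def by simp
        qed
        show "x \<in> group_algebra G' \<and> \<Psi> x = f x" if "x \<in> left_regular G' ` carrier G'" for x
          using that reg reg_in f_reg by auto
      qed
      then show ?thesis by simp
    qed
  qed
  show ?thesis using F uniq by (rule ex1I)
qed

end

theory Submission
  imports Defs
begin

text \<open>
  Each element of the group algebra is determined by its coefficient function, and \<open>\<Psi>\<^sub>U\<close> acts on
  coefficients as the matrix \<open>U\<close>.  Condition (3) says that the transpose of \<open>U\<close> is multiplicative on
  coefficients.  If \<open>U\<close> is unitary, the inverse of the transpose is the entrywise conjugate of \<open>U\<close>, so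
  (3) is equivalent to the multiplicativity of \<open>\<Psi>\<^sub>U\<close>.  Condition (2) is compatibility with the adjoint,
  and the trace reads off the coefficient at the identity.  Conversely, for a unitary isomorphism
  the identity coefficient of \<open>\<Psi>\<^sub>U(\<lambda>'(x\<^sup>-\<^sup>1)) \<Psi>\<^sub>U(\<lambda>'(y))\<close> is the inner product of the columns \<open>x\<close> and \<open>y\<close>
  of \<open>U\<close>, which makes \<open>U\<close> unitary.
\<close>

section \<open>Unitary matrices\<close>

lemma cmat_sum_apply: "(\<Sum>a\<in>A. F a :: 'i \<Rightarrow> 'j \<Rightarrow> complex) i j = (\<Sum>a\<in>A. F a i j)"
  by (induction A rule: infinite_finite_induct) auto

lemma cmats_eq_iff:
  assumes "M \<in> cmats I J" "N \<in> cmats I J"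
  shows "M = N \<longleftrightarrow> (\<forall>i\<in>I. \<forall>j\<in>J. M i j = N i j)"
proof
  assume eq: "\<forall>i\<in>I. \<forall>j\<in>J. M i j = N i j"
  have "M i j = N i j" for i j
    using assms eq by (cases "i \<in> I \<and> j \<in> J") (auto simp: cmats_def)
  then show "M = N" by (intro ext)
qed simp

lemma cmat_unitary_iff:
  assumes "U \<in> cmats I J"
  shows "cmat_unitary I J U \<longleftrightarrow> card I = card J \<and>
    (\<forall>i\<in>I. \<forall>i'\<in>I. (\<Sum>j\<in>J. U i j * cnj (U i' j)) = (if i = i' then 1 else 0)) \<and>
    (\<forall>j\<in>J. \<forall>j'\<in>J. (\<Sum>i\<in>I. cnj (U i j) * U i j') = (if j = j' then 1 else 0))"
proof -
  have "cmat_mult J U (cmat_adjoint U) \<in> cmats I I" "cmat_mult I (cmat_adjoint U) U \<in> cmats J J"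
    using assms by (auto simp: cmats_def cmat_mult_def cmat_adjoint_def)
  moreover have "cmat_one I \<in> cmats I I" "cmat_one J \<in> cmats J J"
    by (auto simp: cmats_def cmat_one_def)
  ultimately show ?thesis
    using assms
    by (simp add: cmat_unitary_def cmats_eq_iff)
       (simp add: cmat_mult_def cmat_adjoint_def cmat_one_def)
qed

lemma cmat_unitary_rows:
  assumes "cmat_unitary I J U" "i \<in> I" "i' \<in> I"
  shows "(\<Sum>j\<in>J. U i j * cnj (U i' j)) = (if i = i' then 1 else 0)"
  using assms cmat_unitary_iff[of U I J] by (auto simp: cmat_unitary_def)

lemma cmat_unitary_cols:
  assumes "cmat_unitary I J U" "j \<in> J" "j' \<in> J"
  shows "(\<Sum>i\<in>I. cnj (U i j) * U i j') = (if j = j' then 1 else 0)"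
  using assms cmat_unitary_iff[of U I J] by (auto simp: cmat_unitary_def)

lemma cmat_unitary_adjoint:
  assumes "cmat_unitary I J U"
  shows "cmat_unitary J I (cmat_adjoint U)"
  using assms by (auto simp: cmat_unitary_def cmat_adjoint_def cmats_def)

lemma cmat_unitary_transpose:
  assumes "cmat_unitary I J U"
  shows "cmat_unitary J I (\<lambda>j i. U i j)"
proof -
  have "(\<lambda>j i. U i j) \<in> cmats J I" "card J = card I"
    using assms by (auto simp: cmat_unitary_def cmats_def)
  then show ?thesis
    using cmat_unitary_rows[OF assms] cmat_unitary_cols[OF assms]
    by (auto simp: cmat_unitary_iff mult.commute)
qed

text \<open>Swapping the two sums exposes the inner products of column \<open>j\<close> with all
  columns. With these as hypotheses, the cancellation is available before \<open>U\<close> is known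
  to be unitary.\<close>

lemma cols_orthonormal_cancel:
  fixes U :: "'i \<Rightarrow> 'j \<Rightarrow> complex"
  assumes "finite J" "j \<in> J"
    and "\<And>j'. j' \<in> J \<Longrightarrow> (\<Sum>i\<in>I. cnj (U i j) * U i j') = (if j = j' then 1 else 0)"
  shows "(\<Sum>i\<in>I. cnj (U i j) * (\<Sum>j'\<in>J. U i j' * f j')) = f j"
proof -
  have "(\<Sum>i\<in>I. cnj (U i j) * (\<Sum>j'\<in>J. U i j' * f j'))
      = (\<Sum>j'\<in>J. (\<Sum>i\<in>I. cnj (U i j) * U i j') * f j')"
    by (simp add: sum_distrib_left sum_distrib_right mult.assoc) (rule sum.swap)
  also have "\<dots> = (\<Sum>j'\<in>J. if j = j' then f j' else 0)"
    by (rule sum.cong) (auto simp: assms(3))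
  also have "\<dots> = f j"
    using assms by simp
  finally show ?thesis .
qed

lemma cmat_unitary_cancel:
  assumes "cmat_unitary I J U" "finite J" "j \<in> J"
  shows "(\<Sum>i\<in>I. cnj (U i j) * (\<Sum>j'\<in>J. U i j' * f j')) = f j"
  using cmat_unitary_cols[OF assms(1)] assms by (intro cols_orthonormal_cancel) auto

lemma cmat_unitary_cancel':
  assumes "cmat_unitary I J U" "finite I" "i \<in> I"
  shows "(\<Sum>j\<in>J. U i j * (\<Sum>i'\<in>I. cnj (U i' j) * f i')) = f i"
  using cmat_unitary_cancel[OF cmat_unitary_adjoint[OF assms(1)] assms(2,3), of f]
  by (simp add: cmat_adjoint_def)

section \<open>Convolution and its transfer along a unitary matrix\<close>

text \<open>For a group product these are the coefficients of a product in the group algebra, and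
  also the right-hand side of condition (3). Carrier and operation are parameters so that the two
  groups can exchange roles.\<close>

definition conv_on :: "'i set \<Rightarrow> ('i \<Rightarrow> 'i \<Rightarrow> 'i) \<Rightarrow> ('i \<Rightarrow> complex) \<Rightarrow> ('i \<Rightarrow> complex) \<Rightarrow> 'i \<Rightarrow> complex"
  where "conv_on A m f h c = (\<Sum>(x, y)\<in>{(x, y). x \<in> A \<and> y \<in> A \<and> m x y = c}. f x * h y)"

text \<open>Sorts the pairs in \<open>A \<times> A\<close> by their product; closure under
  \<open>m\<close> ensures that no pair is lost.\<close>

lemma conv_on_pairing:
  assumes "finite A" "\<And>x y. x \<in> A \<Longrightarrow> y \<in> A \<Longrightarrow> m x y \<in> A"
  shows "(\<Sum>c\<in>A. conv_on A m f h c * u c) = (\<Sum>x\<in>A. \<Sum>y\<in>A. f x * h y * u (m x y))"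
proof -
  have "(\<Sum>c\<in>A. conv_on A m f h c * u c)
      = (\<Sum>c\<in>A. \<Sum>p\<in>{p \<in> A \<times> A. m (fst p) (snd p) = c}. f (fst p) * h (snd p) * u (m (fst p) (snd p)))"
    unfolding conv_on_def sum_distrib_right
    by (intro sum.cong) (auto simp: case_prod_unfold)
  also have "\<dots> = (\<Sum>p\<in>A \<times> A. f (fst p) * h (snd p) * u (m (fst p) (snd p)))"
    using assms by (intro sum.group) auto
  also have "\<dots> = (\<Sum>x\<in>A. \<Sum>y\<in>A. f x * h y * u (m x y))"
    by (simp add: sum.cartesian_product case_prod_unfold)
  finally show ?thesis .
qed

lemma conv_on_cnj: "conv_on A m (\<lambda>x. cnj (f x)) (\<lambda>x. cnj (h x)) c = cnj (conv_on A m f h c)"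
  by (simp add: conv_on_def case_prod_unfold)

text \<open>The inverse of a multiplicative bijection is multiplicative; here the inverse is the adjoint.\<close>

lemma unitary_multiplicative_transpose:
  assumes fin: "finite A" "finite B" and U: "cmat_unitary A B U"
    and clA: "\<And>a b. a \<in> A \<Longrightarrow> b \<in> A \<Longrightarrow> f a b \<in> A"
    and clB: "\<And>x y. x \<in> B \<Longrightarrow> y \<in> B \<Longrightarrow> g x y \<in> B"
    and mult: "\<And>a b c. a \<in> A \<Longrightarrow> b \<in> A \<Longrightarrow> c \<in> B \<Longrightarrow> U (f a b) c = conv_on B g (U a) (U b) c"
    and "x \<in> B" "y \<in> B" "d \<in> A"
  shows "U d (g x y) = conv_on A f (\<lambda>a. U a x) (\<lambda>b. U b y) d"
proof -
  let ?\<delta> = "\<lambda>a b. if f a b = d then 1 else 0 :: complex"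
  \<comment> \<open>The indicator is the inner product of the rows \<open>f a b\<close> and
    \<open>d\<close>; multiplicativity and the pairing formula expand it over
    \<open>B\<close>.\<close>
  have \<delta>: "?\<delta> a b = (\<Sum>x'\<in>B. U a x' * (\<Sum>y'\<in>B. U b y' * cnj (U d (g x' y'))))"
    if "a \<in> A" "b \<in> A" for a b
  proof -
    have "?\<delta> a b = (\<Sum>c\<in>B. conv_on B g (U a) (U b) c * cnj (U d c))"
      using cmat_unitary_rows[OF U, of "f a b" d] that clA \<open>d \<in> A\<close> mult by simp
    also have "\<dots> = (\<Sum>x'\<in>B. \<Sum>y'\<in>B. U a x' * U b y' * cnj (U d (g x' y')))"
      using fin(2) clB by (rule conv_on_pairing)
    finally show ?thesis
      by (simp add: sum_distrib_left mult.assoc)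
  qed
  \<comment> \<open>Conjugation puts \<open>cnj (U a x)\<close> and \<open>cnj (U b y)\<close> in
    front, so that two cancellations reduce the expanded indicator to \<open>x' = x\<close> and
    \<open>y' = y\<close>.\<close>
  have "cnj (conv_on A f (\<lambda>a. U a x) (\<lambda>b. U b y) d)
      = (\<Sum>c\<in>A. conv_on A f (\<lambda>a. cnj (U a x)) (\<lambda>b. cnj (U b y)) c * (if c = d then 1 else 0))"
    using fin \<open>d \<in> A\<close> by (simp add: conv_on_cnj if_distrib[of "(*) _"] cong: if_cong)
  also have "\<dots> = (\<Sum>a\<in>A. \<Sum>b\<in>A. cnj (U a x) * cnj (U b y) * ?\<delta> a b)"
    using fin clA by (intro conv_on_pairing)
  also have "\<dots> = (\<Sum>b\<in>A. cnj (U b y) * (\<Sum>a\<in>A. cnj (U a x) * ?\<delta> a b))"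
    by (subst sum.swap) (simp add: sum_distrib_left mult.left_commute mult.assoc)
  also have "\<dots> = (\<Sum>b\<in>A. cnj (U b y) * (\<Sum>y'\<in>B. U b y' * cnj (U d (g x y'))))"
    using cmat_unitary_cancel[OF U fin(2) \<open>x \<in> B\<close>]
    by (intro sum.cong arg_cong2[where f = "(*)"] refl) (simp add: \<delta>)
  also have "\<dots> = cnj (U d (g x y))"
    by (rule cmat_unitary_cancel[OF U fin(2) \<open>y \<in> B\<close>])
  finally show ?thesis
    by simp
qed

section \<open>Coefficients of group algebra elements\<close>

lemma cmat_linear_on_sum:
  assumes "cmat_linear_on A \<Phi>" "cmat.subspace A" "\<And>i. i \<in> I \<Longrightarrow> M i \<in> A"
  shows "\<Phi> (\<Sum>i\<in>I. cmat_scale (c i) (M i)) = (\<Sum>i\<in>I. cmat_scale (c i) (\<Phi> (M i)))"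
proof -
  have add: "\<Phi> (M + N) = \<Phi> M + \<Phi> N" if "M \<in> A" "N \<in> A" for M N
    using assms(1) that by (auto simp: cmat_linear_on_def)
  have scale: "\<Phi> (cmat_scale c M) = cmat_scale c (\<Phi> M)" if "M \<in> A" for c M
    using assms(1) that by (auto simp: cmat_linear_on_def)
  have 0: "\<Phi> 0 = 0"
    using scale[OF cmat.subspace_0[OF assms(2)], of 0] by simp
  \<comment> \<open>Linearity is given on \<open>A\<close> alone, so the induction also carries
    membership of the partial sums in \<open>A\<close>.\<close>
  have "(\<Sum>i\<in>I. cmat_scale (c i) (M i)) \<in> A \<and> ?thesis"
    using assms(3)
  proof (induction I rule: infinite_finite_induct)
    case (insert i I)
    then have "cmat_scale (c i) (M i) \<in> A" "\<Phi> (cmat_scale (c i) (M i)) = cmat_scale (c i) (\<Phi> (M i))"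
      using cmat.subspace_scale[OF assms(2)] scale by auto
    moreover have "(\<Sum>i\<in>I. cmat_scale (c i) (M i)) \<in> A"
      "\<Phi> (\<Sum>i\<in>I. cmat_scale (c i) (M i)) = (\<Sum>i\<in>I. cmat_scale (c i) (\<Phi> (M i)))"
      using insert by auto
    ultimately show ?case
      unfolding sum.insert[OF insert.hyps]
      by (simp only: add cmat.subspace_add[OF assms(2)] simp_thms)
  qed (simp_all add: 0 cmat.subspace_0[OF assms(2)])
  then show ?thesis ..
qed

text \<open>The combination of the matrices \<lambda>(a) with coefficients \<open>f a\<close>, as
  \<lambda>(a) has its ones where \<open>x \<otimes> inv y = a\<close>. Explicit entries make the
  coefficients easy to read off.\<close>

definition galg :: "('a, 'm) monoid_scheme \<Rightarrow> ('a \<Rightarrow> complex) \<Rightarrow> 'a \<Rightarrow> 'a \<Rightarrow> complex" where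
  "galg G f = (\<lambda>x y. if x \<in> carrier G \<and> y \<in> carrier G then f (x \<otimes>\<^bsub>G\<^esub> inv\<^bsub>G\<^esub> y) else 0)"

section \<open>Operations of the group algebra in coefficients\<close>

locale finite_group = group +
  assumes finite_carrier: "finite (carrier G)"
begin

abbreviation conv :: "('a \<Rightarrow> complex) \<Rightarrow> ('a \<Rightarrow> complex) \<Rightarrow> 'a \<Rightarrow> complex" where
  "conv \<equiv> conv_on (carrier G) (\<otimes>)"

lemma card_pos: "card (carrier G) > 0"
  using finite_carrier one_closed by (auto simp: card_gt_0_iff)

lemma conv_eq:
  assumes "c \<in> carrier G"
  shows "conv f h c = (\<Sum>x\<in>carrier G. f x * h (inv x \<otimes> c))"
  unfolding conv_on_def
  by (rule sum.reindex_bij_witness[of _ "\<lambda>x. (x, inv x \<otimes> c)" fst])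
     (use assms in \<open>auto simp: inv_solve_left' m_assoc[symmetric]\<close>)

lemma left_regular_eq_galg: "a \<in> carrier G \<Longrightarrow> left_regular G a = galg G (\<lambda>b. if b = a then 1 else 0)"
  by (auto simp: left_regular_def galg_def fun_eq_iff m_assoc inv_solve_right')

lemma galg_eq_sum: "galg G f = (\<Sum>a\<in>carrier G. cmat_scale (f a) (left_regular G a))"
proof (intro ext)
  fix x y
  show "galg G f x y = (\<Sum>a\<in>carrier G. cmat_scale (f a) (left_regular G a)) x y"
  proof (cases "x \<in> carrier G \<and> y \<in> carrier G")
    case True
    have "(\<Sum>a\<in>carrier G. cmat_scale (f a) (left_regular G a)) x y
        = (\<Sum>a\<in>carrier G. if a = x \<otimes> inv y then f a else 0)"
      unfolding cmat_sum_apply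
      by (intro sum.cong) (use True in \<open>auto simp: cmat_scale_def left_regular_eq_galg galg_def\<close>)
    then show ?thesis
      using True finite_carrier by (simp add: galg_def)
  next
    case False
    then show ?thesis
      unfolding cmat_sum_apply by (auto simp: galg_def cmat_scale_def left_regular_def)
  qed
qed

text \<open>The column at the identity lists the coefficients; in other words, the matrices
  \<lambda>(a) are linearly independent.\<close>

lemma galg_eq_iff: "galg G f = galg G h \<longleftrightarrow> (\<forall>a\<in>carrier G. f a = h a)"
proof
  assume eq: "galg G f = galg G h"
  show "\<forall>a\<in>carrier G. f a = h a"
  proof
    fix a assume "a \<in> carrier G"
    then show "f a = h a"
      using fun_cong[OF fun_cong[OF eq], of a \<one>] by (simp add: galg_def)
  qed
qed (auto simp: galg_def fun_eq_iff)

lemma subspace_group_algebra: "cmat.subspace (group_algebra G)"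
  by (simp add: group_algebra_def)

lemma left_regular_in: "a \<in> carrier G \<Longrightarrow> left_regular G a \<in> group_algebra G"
  by (auto simp: group_algebra_def intro: cmat.span_base)

lemma galg_in: "galg G f \<in> group_algebra G"
  unfolding galg_eq_sum
  by (intro cmat.subspace_sum cmat.subspace_scale subspace_group_algebra left_regular_in)

text \<open>The matrices \<open>galg G f\<close> form a subspace containing the generators, so they
  exhaust the span.\<close>

lemma group_algebraE:
  assumes "M \<in> group_algebra G"
  obtains f where "M = galg G f"
proof -
  have "M \<in> range (galg G)"
  proof (rule cmat.span_induct[OF assms[unfolded group_algebra_def]])
    show "cmat.subspace {M. M \<in> range (galg G)}"
    proof (rule cmat.subspaceI)
      have "0 = galg G (\<lambda>_. 0)"
        by (auto simp: galg_def fun_eq_iff)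
      then show "0 \<in> {M. M \<in> range (galg G)}" by simp
    next
      fix M N assume "M \<in> {M. M \<in> range (galg G)}" "N \<in> {M. M \<in> range (galg G)}"
      then obtain f h where "M = galg G f" "N = galg G h" by auto
      then have "M + N = galg G (\<lambda>a. f a + h a)"
        by (auto simp: galg_def fun_eq_iff)
      then show "M + N \<in> {M. M \<in> range (galg G)}" by simp
    next
      fix c M assume "M \<in> {M. M \<in> range (galg G)}"
      then obtain f where "M = galg G f" by auto
      then have "cmat_scale c M = galg G (\<lambda>a. c * f a)"
        by (auto simp: galg_def cmat_scale_def fun_eq_iff)
      then show "cmat_scale c M \<in> {M. M \<in> range (galg G)}" by simp
    qed
  qed (auto simp: left_regular_eq_galg)
  then show thesis using that by auto
qed

text \<open>Every diagonal entry is the coefficient at \<open>x \<otimes> inv x\<close>, the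
  identity.\<close>

lemma trace_galg: "cmat_trace (carrier G) (galg G f) = of_nat (card (carrier G)) * f \<one>"
  by (simp add: cmat_trace_def galg_def)

lemma adjoint_galg: "cmat_adjoint (galg G f) = galg G (\<lambda>a. cnj (f (inv a)))"
  by (auto simp: cmat_adjoint_def galg_def fun_eq_iff inv_mult_group)

lemma mult_galg: "cmat_mult (carrier G) (galg G f) (galg G h) = galg G (conv f h)"
proof (intro ext)
  fix x z
  show "cmat_mult (carrier G) (galg G f) (galg G h) x z = galg G (conv f h) x z"
  proof (cases "x \<in> carrier G \<and> z \<in> carrier G")
    case True
    \<comment> \<open>Substitution \<open>a = x \<otimes> inv y\<close>, under which
      \<open>y \<otimes> inv z\<close> becomes
      \<open>inv a \<otimes> (x \<otimes> inv z)\<close>.\<close>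
    have "(\<Sum>y\<in>carrier G. f (x \<otimes> inv y) * h (y \<otimes> inv z))
        = (\<Sum>a\<in>carrier G. f a * h (inv a \<otimes> (x \<otimes> inv z)))"
      by (rule sum.reindex_bij_witness[of _ "\<lambda>a. inv a \<otimes> x" "\<lambda>y. x \<otimes> inv y"])
         (use True in \<open>auto simp: inv_mult_group m_assoc[symmetric]\<close>, simp_all add: m_assoc)
    then show ?thesis
      using True by (simp add: cmat_mult_def galg_def conv_eq)
  qed (auto simp: cmat_mult_def galg_def)
qed

end

section \<open>Transformation matrices and unitary isomorphisms\<close>

locale finite_group_pair = G: finite_group G + G': finite_group G'
  for G :: "('a, 'm) monoid_scheme" and G' :: "('b, 'n) monoid_scheme"
begin

abbreviation "A \<equiv> carrier G"
abbreviation "B \<equiv> carrier G'"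

lemmas fin = G.finite_carrier G'.finite_carrier

lemma transformation_matrix_iff:
  "transformation_matrix G G' U \<longleftrightarrow> cmat_unitary A B U \<and>
    (\<forall>a\<in>A. \<forall>b\<in>B. cnj (U a b) = U (inv\<^bsub>G\<^esub> a) (inv\<^bsub>G'\<^esub> b)) \<and>
    (\<forall>a\<in>A. \<forall>b\<in>A. \<forall>c\<in>B. U (a \<otimes>\<^bsub>G\<^esub> b) c = G'.conv (U a) (U b) c)"
  by (simp add: transformation_matrix_def conv_on_def)

lemma Psi_spec_Psi: "Psi_spec G G' U (Psi G G' U)"
  unfolding Psi_def by (rule theI'[OF Psi_spec_ex1[OF G'.is_group fin(2)]])

lemma Psi_eqI: "Psi_spec G G' U \<Psi> \<Longrightarrow> Psi G G' U = \<Psi>"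
  using Psi_spec_ex1[OF G'.is_group fin(2)] Psi_spec_Psi by blast

lemma Psi_left_regular: "b \<in> B \<Longrightarrow> Psi G G' U (left_regular G' b) = galg G (\<lambda>a. U a b)"
  using Psi_spec_Psi[of U] by (simp add: Psi_spec_def G.galg_eq_sum)

lemma linear_Psi: "cmat_linear_on (group_algebra G') (Psi G G' U)"
  using Psi_spec_Psi[of U] by (simp add: Psi_spec_def)

text \<open>Linear extension from the generators; through it, claims about \<open>Psi\<close> become
  claims about sums of coefficients.\<close>

lemma Psi_galg: "Psi G G' U (galg G' f) = galg G (\<lambda>a. \<Sum>b\<in>B. U a b * f b)"
proof -
  have "Psi G G' U (galg G' f) = (\<Sum>b\<in>B. cmat_scale (f b) (galg G (\<lambda>a. U a b)))"
    unfolding G'.galg_eq_sum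
    by (subst cmat_linear_on_sum[OF linear_Psi G'.subspace_group_algebra])
       (simp_all add: G'.left_regular_in Psi_left_regular)
  also have "\<dots> = galg G (\<lambda>a. \<Sum>b\<in>B. U a b * f b)"
    by (intro ext) (auto simp: cmat_sum_apply cmat_scale_def galg_def mult.commute)
  finally show ?thesis .
qed

section \<open>From transformation matrices to unitary isomorphisms\<close>

text \<open>Prepares trace preservation. Condition (3) with the identity as first factor writes row
  \<open>b\<close> as the convolution of the identity row with row \<open>b\<close>; pairing with
  the identity column then isolates one entry.\<close>

lemma transformation_matrix_one_row:
  assumes "transformation_matrix G G' U" "c \<in> B"
  shows "U \<one>\<^bsub>G\<^esub> c = (if c = \<one>\<^bsub>G'\<^esub> then 1 else 0)"
proof -
  have U: "cmat_unitary A B U"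
    and mult: "\<And>a b. a \<in> A \<Longrightarrow> b \<in> A \<Longrightarrow> U (a \<otimes>\<^bsub>G\<^esub> b) c = G'.conv (U a) (U b) c"
    using assms by (auto simp: transformation_matrix_iff)
  have "(if \<one>\<^bsub>G'\<^esub> = c then 1 else 0) = (\<Sum>b\<in>A. cnj (U b \<one>\<^bsub>G'\<^esub>) * U b c)"
    using cmat_unitary_cols[OF U] assms by simp
  also have "\<dots> = (\<Sum>b\<in>A. cnj (U b \<one>\<^bsub>G'\<^esub>) * (\<Sum>x\<in>B. U \<one>\<^bsub>G\<^esub> x * U b (inv\<^bsub>G'\<^esub> x \<otimes>\<^bsub>G'\<^esub> c)))"
    using mult[of "\<one>\<^bsub>G\<^esub>"] assms by (intro sum.cong) (auto simp: G'.conv_eq)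
  also have "\<dots> = (\<Sum>x\<in>B. U \<one>\<^bsub>G\<^esub> x * (\<Sum>b\<in>A. cnj (U b \<one>\<^bsub>G'\<^esub>) * U b (inv\<^bsub>G'\<^esub> x \<otimes>\<^bsub>G'\<^esub> c)))"
    by (simp add: sum_distrib_left mult.left_commute) (rule sum.swap)
  also have "\<dots> = (\<Sum>x\<in>B. if x = c then U \<one>\<^bsub>G\<^esub> x else 0)"
  proof (rule sum.cong)
    fix x assume x: "x \<in> B"
    \<comment> \<open>Column orthonormality keeps just the term in which column
      \<open>inv x \<otimes> c\<close> is the identity column.\<close>
    have "\<one>\<^bsub>G'\<^esub> = inv\<^bsub>G'\<^esub> x \<otimes>\<^bsub>G'\<^esub> c \<longleftrightarrow> x = c"
      using x assms(2) by (metis G'.inv_closed G'.inv_equality G'.inv_inv G'.l_inv)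
    then show "U \<one>\<^bsub>G\<^esub> x * (\<Sum>b\<in>A. cnj (U b \<one>\<^bsub>G'\<^esub>) * U b (inv\<^bsub>G'\<^esub> x \<otimes>\<^bsub>G'\<^esub> c))
        = (if x = c then U \<one>\<^bsub>G\<^esub> x else 0)"
      using cmat_unitary_cols[OF U, of "\<one>\<^bsub>G'\<^esub>" "inv\<^bsub>G'\<^esub> x \<otimes>\<^bsub>G'\<^esub> c"] x assms(2) by simp
  qed simp
  also have "\<dots> = U \<one>\<^bsub>G\<^esub> c"
    using assms fin by simp
  finally show ?thesis
    by (auto simp: eq_commute)
qed

lemma unitary_iso_Psi:
  assumes "transformation_matrix G G' U"
  shows "unitary_iso B A (group_algebra G') (group_algebra G) (Psi G G' U)"
proof -
  have U: "cmat_unitary A B U"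
    and star: "\<And>a b. a \<in> A \<Longrightarrow> b \<in> B \<Longrightarrow> cnj (U a b) = U (inv\<^bsub>G\<^esub> a) (inv\<^bsub>G'\<^esub> b)"
    and mult: "\<And>a b c. a \<in> A \<Longrightarrow> b \<in> A \<Longrightarrow> c \<in> B \<Longrightarrow> U (a \<otimes>\<^bsub>G\<^esub> b) c = G'.conv (U a) (U b) c"
    using assms by (auto simp: transformation_matrix_iff)
  have bij: "bij_betw (Psi G G' U) (group_algebra G') (group_algebra G)"
  proof (rule bij_betwI')
    fix M N assume "M \<in> group_algebra G'" "N \<in> group_algebra G'"
    then obtain f h where MN: "M = galg G' f" "N = galg G' h"
      using G'.group_algebraE by metis
    show "Psi G G' U M = Psi G G' U N \<longleftrightarrow> M = N"
    proof
      assume "Psi G G' U M = Psi G G' U N"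
      then have eq: "(\<Sum>b\<in>B. U a b * f b) = (\<Sum>b\<in>B. U a b * h b)" if "a \<in> A" for a
        using that by (simp add: MN Psi_galg G.galg_eq_iff)
      have "f b = h b" if "b \<in> B" for b
      proof -
        have "f b = (\<Sum>a\<in>A. cnj (U a b) * (\<Sum>b'\<in>B. U a b' * f b'))"
          by (rule cmat_unitary_cancel[OF U fin(2) that, symmetric])
        also have "\<dots> = (\<Sum>a\<in>A. cnj (U a b) * (\<Sum>b'\<in>B. U a b' * h b'))"
          by (rule sum.cong) (simp_all add: eq)
        also have "\<dots> = h b"
          by (rule cmat_unitary_cancel[OF U fin(2) that])
        finally show ?thesis .
      qed
      then show "M = N"
        by (simp add: MN G'.galg_eq_iff)
    qed simp
  next
    fix M assume "M \<in> group_algebra G'"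
    then show "Psi G G' U M \<in> group_algebra G"
      by (metis G'.group_algebraE Psi_galg G.galg_in)
  next
    fix N assume "N \<in> group_algebra G"
    then obtain h where N: "N = galg G h"
      using G.group_algebraE by metis
    \<comment> \<open>The inverse map acts on coefficients by the adjoint of
      \<open>U\<close>.\<close>
    have "N = Psi G G' U (galg G' (\<lambda>b. \<Sum>a\<in>A. cnj (U a b) * h a))"
      by (simp add: N Psi_galg G.galg_eq_iff cmat_unitary_cancel'[OF U fin(1)])
    then show "\<exists>M\<in>group_algebra G'. N = Psi G G' U M"
      using G'.galg_in by blast
  qed
  have hom: "Psi G G' U (cmat_mult B (galg G' f) (galg G' h))
      = cmat_mult A (Psi G G' U (galg G' f)) (Psi G G' U (galg G' h))" for f h
  proof -
    have "(\<Sum>b\<in>B. U d b * G'.conv f h b)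
        = G.conv (\<lambda>a. \<Sum>x\<in>B. U a x * f x) (\<lambda>a. \<Sum>y\<in>B. U a y * h y) d" if d: "d \<in> A" for d
    proof -
      have "(\<Sum>b\<in>B. U d b * G'.conv f h b) = (\<Sum>b\<in>B. G'.conv f h b * U d b)"
        by (simp add: mult.commute)
      also have "\<dots> = (\<Sum>x\<in>B. \<Sum>y\<in>B. f x * h y * U d (x \<otimes>\<^bsub>G'\<^esub> y))"
        using fin by (intro conv_on_pairing) auto
      \<comment> \<open>Condition (3) concerns products of row indices; its transposed form handles
        this product of column indices.\<close>
      also have "\<dots> = (\<Sum>x\<in>B. \<Sum>y\<in>B. f x * h y * G.conv (\<lambda>a. U a x) (\<lambda>b. U b y) d)"
        using d by (intro sum.cong refl arg_cong2[where f = "(*)"]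
          unitary_multiplicative_transpose[where f = "(\<otimes>\<^bsub>G\<^esub>)" and g = "(\<otimes>\<^bsub>G'\<^esub>)", OF fin U _ _ mult]) auto
      also have "\<dots> = (\<Sum>x\<in>B. \<Sum>y\<in>B. \<Sum>a\<in>A. f x * h y * (U a x * U (inv\<^bsub>G\<^esub> a \<otimes>\<^bsub>G\<^esub> d) y))"
        using d by (simp add: G.conv_eq sum_distrib_left)
      also have "\<dots> = (\<Sum>x\<in>B. \<Sum>a\<in>A. \<Sum>y\<in>B. f x * h y * (U a x * U (inv\<^bsub>G\<^esub> a \<otimes>\<^bsub>G\<^esub> d) y))"
        by (intro sum.cong refl) (rule sum.swap)
      also have "\<dots> = (\<Sum>a\<in>A. \<Sum>x\<in>B. \<Sum>y\<in>B. f x * h y * (U a x * U (inv\<^bsub>G\<^esub> a \<otimes>\<^bsub>G\<^esub> d) y))"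
        by (rule sum.swap)
      also have "\<dots> = G.conv (\<lambda>a. \<Sum>x\<in>B. U a x * f x) (\<lambda>a. \<Sum>y\<in>B. U a y * h y) d"
        using d by (simp add: G.conv_eq sum_product algebra_simps)
      finally show ?thesis .
    qed
    then show ?thesis
      by (simp add: G'.mult_galg G.mult_galg Psi_galg G.galg_eq_iff)
  qed
  \<comment> \<open>The identity row extracts the coefficient at the identity, and unitarity
    includes equality of the two orders, which are the factors in the traces.\<close>
  have tr: "cmat_trace A (Psi G G' U (galg G' f)) = cmat_trace B (galg G' f)" for f
  proof -
    have "(\<Sum>b\<in>B. U \<one>\<^bsub>G\<^esub> b * f b) = (\<Sum>b\<in>B. if b = \<one>\<^bsub>G'\<^esub> then f b else 0)"
      by (rule sum.cong) (auto simp: transformation_matrix_one_row[OF assms])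
    also have "\<dots> = f \<one>\<^bsub>G'\<^esub>"
      using fin by simp
    finally show ?thesis
      using U by (simp add: Psi_galg G.trace_galg G'.trace_galg cmat_unitary_def)
  qed
  have adj: "Psi G G' U (cmat_adjoint (galg G' f)) = cmat_adjoint (Psi G G' U (galg G' f))" for f
  proof -
    have "(\<Sum>b\<in>B. U a b * cnj (f (inv\<^bsub>G'\<^esub> b))) = cnj (\<Sum>b\<in>B. U (inv\<^bsub>G\<^esub> a) b * f b)"
      if a: "a \<in> A" for a
    proof -
      \<comment> \<open>Inverting the summation index brings the entries into the form of condition
        (2).\<close>
      have "(\<Sum>b\<in>B. U a b * cnj (f (inv\<^bsub>G'\<^esub> b))) = (\<Sum>b\<in>B. U a (inv\<^bsub>G'\<^esub> b) * cnj (f b))"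
        by (rule sum.reindex_bij_witness[of _ "m_inv G'" "m_inv G'"]) auto
      also have "\<dots> = cnj (\<Sum>b\<in>B. U (inv\<^bsub>G\<^esub> a) b * f b)"
        using a by (simp add: star)
      finally show ?thesis .
    qed
    then show ?thesis
      by (simp add: G'.adjoint_galg G.adjoint_galg Psi_galg G.galg_eq_iff)
  qed
  show ?thesis
    unfolding unitary_iso_def algebra_iso_def
    using bij linear_Psi hom tr adj by (auto elim!: G'.group_algebraE)
qed

section \<open>From unitary isomorphisms to transformation matrices\<close>

text \<open>Generators as test elements yield (2) and the transposed form of (3); traces yield the
  identity row. Together these make the columns orthonormal, surjectivity supplies the rows, and
  transposing back gives (3).\<close>

lemma transformation_matrix_if_unitary_iso:
  assumes cm: "U \<in> cmats A B"
    and iso: "unitary_iso B A (group_algebra G') (group_algebra G) (Psi G G' U)"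
  shows "transformation_matrix G G' U"
proof -
  let ?\<Psi> = "Psi G G' U"
  have bij: "bij_betw ?\<Psi> (group_algebra G') (group_algebra G)"
    and hom: "\<And>f h. ?\<Psi> (cmat_mult B (galg G' f) (galg G' h))
        = cmat_mult A (?\<Psi> (galg G' f)) (?\<Psi> (galg G' h))"
    and tr: "\<And>f. cmat_trace A (?\<Psi> (galg G' f)) = cmat_trace B (galg G' f)"
    and adj: "\<And>f. ?\<Psi> (cmat_adjoint (galg G' f)) = cmat_adjoint (?\<Psi> (galg G' f))"
    using iso G'.galg_in by (auto simp: unitary_iso_def algebra_iso_def)
  define e where "e b = (\<lambda>x. if x = b then 1 else 0 :: complex)" for b :: 'b
  have \<Psi>_e: "?\<Psi> (galg G' (e b)) = galg G (\<lambda>a. U a b)" if "b \<in> B" for b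
    using Psi_left_regular[OF that] that by (simp add: G'.left_regular_eq_galg e_def)
  have conv_e: "G'.conv (e x) f c = f (inv\<^bsub>G'\<^esub> x \<otimes>\<^bsub>G'\<^esub> c)" if "x \<in> B" "c \<in> B" for x f c
  proof -
    have "G'.conv (e x) f c = (\<Sum>y\<in>B. if y = x then f (inv\<^bsub>G'\<^esub> y \<otimes>\<^bsub>G'\<^esub> c) else 0)"
      unfolding G'.conv_eq[OF that(2)] by (rule sum.cong) (auto simp: e_def)
    then show ?thesis using that fin by simp
  qed
  have conv_e_e: "galg G' (G'.conv (e x) (e y)) = galg G' (e (x \<otimes>\<^bsub>G'\<^esub> y))"
    if "x \<in> B" "y \<in> B" for x y
    using that by (simp add: G'.galg_eq_iff conv_e) (simp add: e_def G'.inv_solve_left')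
  have mult: "U d (x \<otimes>\<^bsub>G'\<^esub> y) = G.conv (\<lambda>a. U a x) (\<lambda>a. U a y) d"
    if "x \<in> B" "y \<in> B" "d \<in> A" for x y d
    using hom[of "e x" "e y"] that
    by (simp add: G'.mult_galg conv_e_e \<Psi>_e G.mult_galg G.galg_eq_iff)
  have star: "cnj (U a b) = U (inv\<^bsub>G\<^esub> a) (inv\<^bsub>G'\<^esub> b)" if "a \<in> A" "b \<in> B" for a b
  proof -
    have "cmat_adjoint (galg G' (e b)) = galg G' (e (inv\<^bsub>G'\<^esub> b))"
      using that by (auto simp: G'.adjoint_galg G'.galg_eq_iff e_def)
    then have "U (inv\<^bsub>G\<^esub> a) (inv\<^bsub>G'\<^esub> b) = cnj (U (inv\<^bsub>G\<^esub> (inv\<^bsub>G\<^esub> a)) b)"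
      using adj[of "e b"] that by (simp add: \<Psi>_e G.adjoint_galg G.galg_eq_iff)
    then show ?thesis using that by simp
  qed
  \<comment> \<open>The two orders are not yet known to agree, so both factors stay.\<close>
  have tr_U: "of_nat (card A) * U \<one>\<^bsub>G\<^esub> b = of_nat (card B) * e b \<one>\<^bsub>G'\<^esub>" if "b \<in> B" for b
    using tr[of "e b"] that by (simp add: \<Psi>_e G.trace_galg G'.trace_galg)
  have surj: "\<exists>f. ?\<Psi> (galg G' f) = galg G h" for h
    using bij G.galg_in[of h] by (metis G'.group_algebraE bij_betw_imp_surj_on imageE)

  \<comment> \<open>Coefficients of the identity matrix, the unit of
    \<open>group_algebra G\<close>.\<close>
  define i where "i = (\<lambda>a. if a = \<one>\<^bsub>G\<^esub> then 1 else 0 :: complex)"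
  \<comment> \<open>Surjectivity gives a preimage of the unit. Multiplying it by the unit of the
    source before applying \<open>?\<Psi>\<close> shows that units correspond.\<close>
  have "U \<one>\<^bsub>G\<^esub> \<one>\<^bsub>G'\<^esub> = 1"
  proof -
    obtain f where f: "?\<Psi> (galg G' f) = galg G i" using surj by blast
    have i: "G.conv h i d = h d" if "d \<in> A" for h d
    proof -
      have "G.conv h i d = (\<Sum>a\<in>A. if a = d then h a else 0)"
        unfolding G.conv_eq[OF that] i_def
        by (rule sum.cong) (use that in \<open>auto simp: G.inv_solve_left'\<close>)
      then show ?thesis using that fin by simp
    qed
    have "galg G (\<lambda>a. U a \<one>\<^bsub>G'\<^esub>) = galg G (G.conv (\<lambda>a. U a \<one>\<^bsub>G'\<^esub>) i)"
      by (simp add: G.galg_eq_iff i)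
    also have "\<dots> = ?\<Psi> (cmat_mult B (galg G' (e \<one>\<^bsub>G'\<^esub>)) (galg G' f))"
      by (simp add: hom f \<Psi>_e G.mult_galg)
    also have "cmat_mult B (galg G' (e \<one>\<^bsub>G'\<^esub>)) (galg G' f) = galg G' f"
      by (simp add: G'.mult_galg G'.galg_eq_iff conv_e)
    finally show ?thesis
      by (simp add: f G.galg_eq_iff i_def)
  qed
  \<comment> \<open>With this entry known, the trace relation at the identity equates the
    orders.\<close>
  then have card_eq: "card A = card B"
    using tr_U[of "\<one>\<^bsub>G'\<^esub>"] by (simp add: e_def)
  then have one_row: "U \<one>\<^bsub>G\<^esub> b = e b \<one>\<^bsub>G'\<^esub>" if "b \<in> B" for b
    using tr_U[OF that] G'.card_pos by simp
  have cols: "(\<Sum>a\<in>A. cnj (U a x) * U a y) = (if x = y then 1 else 0)" if "x \<in> B" "y \<in> B" for x y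
  proof -
    \<comment> \<open>Condition (2) trades conjugation for inverses. The inner product is then the
      value at the identity of the convolution of columns \<open>inv x\<close> and \<open>y\<close>,
      hence an entry of the identity row.\<close>
    have "(\<Sum>a\<in>A. cnj (U a x) * U a y) = (\<Sum>a\<in>A. U (inv\<^bsub>G\<^esub> a) (inv\<^bsub>G'\<^esub> x) * U a y)"
      using that by (simp add: star)
    also have "\<dots> = (\<Sum>a\<in>A. U a (inv\<^bsub>G'\<^esub> x) * U (inv\<^bsub>G\<^esub> a) y)"
      by (rule sum.reindex_bij_witness[of _ "m_inv G" "m_inv G"]) auto
    also have "\<dots> = U \<one>\<^bsub>G\<^esub> (inv\<^bsub>G'\<^esub> x \<otimes>\<^bsub>G'\<^esub> y)"
      using that by (simp add: mult G.conv_eq)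
    also have "\<dots> = (if x = y then 1 else 0)"
      using that by (auto simp: one_row e_def G'.inv_solve_left)
    finally show ?thesis .
  qed
  \<comment> \<open>A right inverse of \<open>U\<close>, given by surjectivity, must be the left inverse \<open>U\<^sup>\<dagger>\<close>.\<close>
  have rows: "(\<Sum>b\<in>B. U a b * cnj (U a' b)) = (if a = a' then 1 else 0)"
    if "a \<in> A" "a' \<in> A" for a a'
  proof -
    obtain w where "?\<Psi> (galg G' w) = galg G (\<lambda>d. if d = a' then 1 else 0)"
      using surj by blast
    then have w: "(\<Sum>b\<in>B. U d b * w b) = (if d = a' then 1 else 0)" if "d \<in> A" for d
      using that by (simp add: Psi_galg G.galg_eq_iff)
    have "w b = cnj (U a' b)" if "b \<in> B" for b
    proof -
      have "w b = (\<Sum>d\<in>A. cnj (U d b) * (\<Sum>b'\<in>B. U d b' * w b'))"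
        using fin that cols by (intro cols_orthonormal_cancel[symmetric]) auto
      also have "\<dots> = (\<Sum>d\<in>A. if d = a' then cnj (U d b) else 0)"
        by (rule sum.cong) (simp_all add: w)
      also have "\<dots> = cnj (U a' b)"
        using fin \<open>a' \<in> A\<close> by simp
      finally show ?thesis .
    qed
    then show ?thesis
      using w[OF \<open>a \<in> A\<close>] by simp
  qed
  have U: "cmat_unitary A B U"
    using cm card_eq rows cols by (simp add: cmat_unitary_iff)
  \<comment> \<open>The transpose of \<open>U\<close> is unitary and \<open>mult\<close> is its
    multiplicativity, so the transposition lemma applies with the groups exchanged.\<close>
  have "U (a \<otimes>\<^bsub>G\<^esub> b) c = G'.conv (U a) (U b) c" if "a \<in> A" "b \<in> A" "c \<in> B" for a b c
    using that
    by (intro unitary_multiplicative_transpose[where f = "(\<otimes>\<^bsub>G'\<^esub>)" and g = "(\<otimes>\<^bsub>G\<^esub>)",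
          OF fin(2,1) cmat_unitary_transpose[OF U] _ _ mult]) auto
  then show ?thesis
    using U star by (simp add: transformation_matrix_iff)
qed

section \<open>Realization of unitary isomorphisms by matrices\<close>

text \<open>The restriction appears because \<open>Psi\<close> is \<open>undefined\<close> off the
  group algebra, where \<open>\<Phi>\<close> may take any values.\<close>

lemma unitary_iso_eq_Psi:
  assumes iso: "unitary_iso B A (group_algebra G') (group_algebra G) \<Phi>"
  obtains U where "U \<in> cmats A B" "Psi G G' U = restrict \<Phi> (group_algebra G')"
proof -
  \<comment> \<open>The identity column lists the coefficients of
    \<open>\<Phi> (left_regular G' b)\<close>; the zeros elsewhere put \<open>U\<close> into
    \<open>cmats A B\<close>.\<close>
  define U where "U a b = (if a \<in> A \<and> b \<in> B then \<Phi> (left_regular G' b) a \<one>\<^bsub>G\<^esub> else 0)" for a b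
  have lin: "cmat_linear_on (group_algebra G') \<Phi>"
    and maps: "\<And>M. M \<in> group_algebra G' \<Longrightarrow> \<Phi> M \<in> group_algebra G"
    using iso by (auto simp: unitary_iso_def algebra_iso_def bij_betw_def)
  have reg: "\<Phi> (left_regular G' b) = galg G (\<lambda>a. U a b)" if b: "b \<in> B" for b
  proof -
    obtain f where f: "\<Phi> (left_regular G' b) = galg G f"
      using maps G'.left_regular_in[OF b] G.group_algebraE by metis
    then have "U a b = f a" if "a \<in> A" for a
      using that b by (simp add: U_def galg_def)
    then show ?thesis by (simp add: f G.galg_eq_iff)
  qed
  have "cmat_linear_on (group_algebra G') (restrict \<Phi> (group_algebra G'))"
    using lin cmat.subspace_add[OF G'.subspace_group_algebra]
      cmat.subspace_scale[OF G'.subspace_group_algebra]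
    by (auto simp: cmat_linear_on_def)
  then have "Psi_spec G G' U (restrict \<Phi> (group_algebra G'))"
    using maps reg by (auto simp: Psi_spec_def G'.left_regular_in G.galg_eq_sum)
  moreover have "U \<in> cmats A B"
    by (auto simp: cmats_def U_def)
  ultimately show thesis
    using that Psi_eqI by blast
qed

text \<open>The conditions evaluate \<open>\<Phi>\<close> at sums, multiples, products and adjoints
  as well, and the group algebra is closed under all of these.\<close>

lemma unitary_iso_restrict:
  assumes "unitary_iso B A (group_algebra G') (group_algebra G) \<Phi>"
  shows "unitary_iso B A (group_algebra G') (group_algebra G) (restrict \<Phi> (group_algebra G'))"
proof -
  have "cmat_mult B M N \<in> group_algebra G'" if "M \<in> group_algebra G'" "N \<in> group_algebra G'" for M N
    using that by (metis G'.group_algebraE G'.mult_galg G'.galg_in)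
  moreover have "cmat_adjoint M \<in> group_algebra G'" if "M \<in> group_algebra G'" for M
    using that by (metis G'.group_algebraE G'.adjoint_galg G'.galg_in)
  moreover have "bij_betw (restrict \<Phi> (group_algebra G')) (group_algebra G') (group_algebra G)"
    using assms by (simp add: unitary_iso_def algebra_iso_def)
  ultimately show ?thesis
    using assms cmat.subspace_add[OF G'.subspace_group_algebra]
      cmat.subspace_scale[OF G'.subspace_group_algebra]
    by (simp add: unitary_iso_def algebra_iso_def cmat_linear_on_def)
qed

end

theorem theorem7p5:
  fixes G :: "('a, 'm) monoid_scheme" and G' :: "('b, 'n) monoid_scheme"
  assumes "group G" and "finite (carrier G)"
    and "group G'" and "finite (carrier G')"
  shows "(\<forall>U\<in>cmats (carrier G) (carrier G').
            transformation_matrix G G' U \<longleftrightarrow>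
            unitary_iso (carrier G') (carrier G) (group_algebra G') (group_algebra G) (Psi G G' U)) \<and>
         (\<forall>\<Phi>. unitary_iso (carrier G') (carrier G) (group_algebra G') (group_algebra G) \<Phi> \<longrightarrow>
            (\<exists>U. transformation_matrix G G' U \<and>
                 (\<forall>M\<in>group_algebra G'. \<Phi> M = Psi G G' U M)))"
proof -
  interpret finite_group_pair G G'
    using assms by (intro finite_group_pair.intro finite_group.intro finite_group_axioms.intro)
  show ?thesis
  proof (intro conjI ballI iffI allI impI)
    fix \<Phi> assume iso: "unitary_iso B A (group_algebra G') (group_algebra G) \<Phi>"
    then obtain U where U: "U \<in> cmats A B" "Psi G G' U = restrict \<Phi> (group_algebra G')"
      by (rule unitary_iso_eq_Psi)
    \<comment> \<open>The restriction of \<open>\<Phi>\<close> is a unitary isomorphism equal to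
      \<open>Psi G G' U\<close>, which reduces the claim to the equivalence.\<close>
    then have "transformation_matrix G G' U"
      using unitary_iso_restrict[OF iso] transformation_matrix_if_unitary_iso by simp
    then show "\<exists>U. transformation_matrix G G' U \<and> (\<forall>M\<in>group_algebra G'. \<Phi> M = Psi G G' U M)"
      using U by auto
  qed (use unitary_iso_Psi transformation_matrix_if_unitary_iso in auto)
qed

end
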